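(* Let $\bar x\in\mathcal{SE}$ be a local optimal solution to the problem of minimizing $\vartheta(x)$ subject to $x\in\mathcal{SE}$. Suppose that: (i) $f$ is $B$-differentiable at $\bar x$, uniformly on $K$, with family of derivatives $\{D_Bf(\bar x,z):\ z\in K\}$; (ii) a local error bound is valid near $\bar x$, i.e. there exist $\kappa>0$ and $\delta>0$ such that $\mathrm{dist}(x;\mathcal{SE})\le\kappa\,\nu(x)$ for all $x\in B(\bar x;\delta)\cap K$. Then $$-\widehat{\partial}^+\vartheta(\bar x)\subseteq\left(\bigcap_{z\in K}D_Bf(\bar x,z)^{-1}(C)\cap T_{\rm r}(\bar x;K)\right)^{\ominus}.$$
   Context: Setting: $f:\mathbb{R}^n\times\mathbb{R}^n\to\mathbb{R}^m$ is a mapping, $C\subset\mathbb{R}^m$ is a nontrivial closed, convex, pointed cone, and $K\subseteq\mathbb{R}^n$ is a nonempty closed set. The strong vector equilibrium problem asks for $x\in K$ with $f(x,z)\in C$ for all $z\in K$; its solution set is $\mathcal{SE}=\{x\in K:\ f(x,z)\in C\ \ \forall z\in K\}$. The objective function $\vartheta:\mathbb{R}^n\to\mathbb{R}$ is assumed continuous around (i.e. in a neighborhood of) $\bar x$. Notation: $B(x;r)$ is the closed ball of center $x$ and radius $r$; $\mathrm{dist}(x;S)$ is the Euclidean distance of $x$ from the set $S$. The function $\nu$ is defined by $\nu(x)=\sup_{z\in K}\mathrm{dist}(f(x,z);C)\in[0,+\infty]$. For a cone $S\subseteq\mathbb{R}^n$, $S^{\ominus}=\{v\in\mathbb{R}^n:\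 \langle v,s\rangle\le0\ \forall s\in S\}$. The cone of radial directions to $K$ at $\bar x\in K$ is $T_{\rm r}(\bar x;K)=\{v\in\mathbb{R}^n:\ \forall\epsilon>0\ \exists t_\epsilon\in(0,\epsilon):\ \bar x+t_\epsilon v\in K\}$. The Fréchet upper subdifferential of $\vartheta$ at $\bar x$ is $$\widehat{\partial}^+\vartheta(\bar x)=\left\{v\in\mathbb{R}^n:\ \limsup_{x\to\bar x}\frac{\vartheta(x)-\vartheta(\bar x)-\langle v,x-\bar x\rangle}{\|x-\bar x\|}\le0\right\}.$$ $\mathcal{PH}(\mathbb{R}^n,\mathbb{R}^m)$ is the space of continuous positively homogeneous mappings from $\mathbb{R}^n$ to $\mathbb{R}^m$. $f$ is $B$-differentiable at $\bar x\in K$, uniformly on $K$, if there is a family $\{D_Bf(\bar x,z)\in\mathcal{PH}(\mathbb{R}^n,\mathbb{R}^m):\ z\in K\}$ such that for every $\epsilon>0$ there is $\delta_\epsilon>0$ with $$\sup_{z\in K}\frac{\|f(x,z)-f(\bar x,z)-D_Bf(\bar x,z)(x-\bar x)\|}{\|x-\bar x\|}<\epsilon\quad\forall x\in B(\bar x;\delta_\epsilon),\ x\neq\bar x.$$ $D_Bf(\bar x,z)^{-1}(C)$ denotes the preimage $\{v\in\mathbb{R}^n:\ D_Bf(\bar x,z)(v)\in C\}$. *)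

theory Defs
  imports "HOL-Analysis.Analysis"
begin

definition pointed :: "'a::real_vector set \<Rightarrow> bool" where
  "pointed C \<longleftrightarrow> C \<inter> uminus ` C = {0}"

definition SE :: "('a \<Rightarrow> 'a \<Rightarrow> 'b) \<Rightarrow> 'b set \<Rightarrow> 'a set \<Rightarrow> 'a set" where
  "SE f C K = {x \<in> K. \<forall>z\<in>K. f x z \<in> C}"

text \<open>The supremum is taken in the extended reals, so it may be infinite. It is nonnegative
  as soon as \<open>K\<close> is nonempty; and \<open>infdist\<close> is the usual distance as soon as its second
  argument is nonempty.\<close>

definition merit ::
    "('a \<Rightarrow> 'a \<Rightarrow> 'b::metric_space) \<Rightarrow> 'b set \<Rightarrow> 'a set \<Rightarrow> 'a \<Rightarrow> ereal" where
  "merit f C K x = (SUP z\<in>K. ereal (infdist (f x z) C))"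

definition local_error_bound ::
    "('a::metric_space \<Rightarrow> 'a \<Rightarrow> 'b::metric_space) \<Rightarrow> 'b set \<Rightarrow> 'a set \<Rightarrow> 'a \<Rightarrow> bool" where
  "local_error_bound f C K xbar \<longleftrightarrow>
     (\<exists>\<kappa>>0. \<exists>\<delta>>0. \<forall>x \<in> cball xbar \<delta> \<inter> K.
        ereal (infdist x (SE f C K)) \<le> ereal \<kappa> * merit f C K x)"

definition local_minimizer_on ::
    "('a::metric_space \<Rightarrow> real) \<Rightarrow> 'a set \<Rightarrow> 'a \<Rightarrow> bool" where
  "local_minimizer_on \<theta> S xbar \<longleftrightarrow>
     xbar \<in> S \<and> (\<exists>r>0. \<forall>x \<in> S \<inter> cball xbar r. \<theta> xbar \<le> \<theta> x)"

definition continuous_around ::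
    "('a::topological_space \<Rightarrow> 'b::topological_space) \<Rightarrow> 'a \<Rightarrow> bool" where
  "continuous_around g xbar \<longleftrightarrow> (\<exists>U. open U \<and> xbar \<in> U \<and> continuous_on U g)"

definition polar_cone :: "'a::real_inner set \<Rightarrow> 'a set" where
  "polar_cone S = {v. \<forall>s\<in>S. v \<bullet> s \<le> 0}"

definition radial_cone :: "'a::real_vector \<Rightarrow> 'a set \<Rightarrow> 'a set" where
  "radial_cone xbar K = {v. \<forall>\<epsilon>>0. \<exists>t::real. 0 < t \<and> t < \<epsilon> \<and> xbar + t *\<^sub>R v \<in> K}"

definition frechet_upper_subdiff ::
    "('a::real_inner \<Rightarrow> real) \<Rightarrow> 'a \<Rightarrow> 'a set" where
  "frechet_upper_subdiff \<theta> xbar =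
     {v. Limsup (at xbar)
           (\<lambda>x. ereal ((\<theta> x - \<theta> xbar - v \<bullet> (x - xbar)) / norm (x - xbar))) \<le> 0}"

definition PH :: "('a::real_normed_vector \<Rightarrow> 'b::real_normed_vector) set" where
  "PH = {h. continuous_on UNIV h \<and> (\<forall>t>0. \<forall>x. h (t *\<^sub>R x) = t *\<^sub>R h x)}"

text \<open>Here \<open>Df z\<close> stands for the \<open>B\<close>-derivative of \<open>\<lambda>x. f x z\<close> at \<open>xbar\<close>; only its values
  for \<open>z \<in> K\<close> matter.\<close>

definition B_differentiable_unif ::
    "('a::real_normed_vector \<Rightarrow> 'a \<Rightarrow> 'b::real_normed_vector) \<Rightarrow> 'a set \<Rightarrow> 'a
       \<Rightarrow> ('a \<Rightarrow> 'a \<Rightarrow> 'b) \<Rightarrow> bool" where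
  "B_differentiable_unif f K xbar Df \<longleftrightarrow>
     (\<forall>z\<in>K. Df z \<in> PH) \<and>
     (\<forall>\<epsilon>>0. \<exists>\<delta>>0. \<forall>x \<in> cball xbar \<delta>. x \<noteq> xbar \<longrightarrow>
        (SUP z\<in>K. ereal (norm (f x z - f xbar z - Df z (x - xbar)) / norm (x - xbar))) < ereal \<epsilon>)"

end

theory Submission
  imports Defs
begin

text \<open>Along a radial direction \<open>s\<close> with \<open>Df z s \<in> C\<close> for all \<open>z\<close>, the points
  \<open>x = xbar + t s\<close> of \<open>K\<close> have merit \<open>o(t)\<close>, because \<open>f xbar z + t Df z s\<close> stays in the convex
  cone \<open>C\<close>. The error bound then gives solutions \<open>y\<close> with \<open>y = x + o(t)\<close>, and local optimality
  together with the upper subgradient inequality at \<open>y\<close> yields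
  \<open>0 \<le> \<theta> y - \<theta> xbar \<le> t (v \<bullet> s) + o(t)\<close>.\<close>

lemma frechet_upper_subdiffD:
  assumes "v \<in> frechet_upper_subdiff \<theta> xbar" and "\<eta> > 0"
  shows "\<exists>d>0. \<forall>y. dist y xbar < d \<longrightarrow>
           \<theta> y - \<theta> xbar - v \<bullet> (y - xbar) \<le> \<eta> * norm (y - xbar)"
proof -
  have "Limsup (at xbar)
      (\<lambda>x. ereal ((\<theta> x - \<theta> xbar - v \<bullet> (x - xbar)) / norm (x - xbar))) \<le> 0"
    using assms unfolding frechet_upper_subdiff_def by blast
  also have "0 < ereal \<eta>" using assms by simp
  finally have "Limsup (at xbar)
      (\<lambda>x. ereal ((\<theta> x - \<theta> xbar - v \<bullet> (x - xbar)) / norm (x - xbar))) < ereal \<eta>" .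
  then have "\<forall>\<^sub>F x in at xbar. (\<theta> x - \<theta> xbar - v \<bullet> (x - xbar)) / norm (x - xbar) < \<eta>"
    by (rule eventually_mono[OF Limsup_lessD]) simp
  then obtain d where d: "d > 0"
    "\<And>y. y \<noteq> xbar \<Longrightarrow> dist y xbar < d \<Longrightarrow>
       (\<theta> y - \<theta> xbar - v \<bullet> (y - xbar)) / norm (y - xbar) < \<eta>"
    unfolding eventually_at by blast
  show ?thesis
  proof (intro exI[of _ d] conjI d(1) allI impI)
    fix y assume y: "dist y xbar < d"
    show "\<theta> y - \<theta> xbar - v \<bullet> (y - xbar) \<le> \<eta> * norm (y - xbar)"
    \<comment> \<open>The punctured limit says nothing at \<open>xbar\<close> itself; there both
      sides of the claim vanish.\<close>
    proof (cases "y = xbar")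
      case False
      then show ?thesis using d(2)[OF False y] by (simp add: divide_less_eq)
    qed simp
  qed
qed

text \<open>Each quotient lies below the supremum over \<open>K\<close>. The gain is that one radius
  \<open>d\<close> serves all \<open>z\<close> at once, so later bounds can pass to the supremum
  defining \<open>merit\<close>.\<close>

lemma B_differentiable_unifD:
  assumes "B_differentiable_unif f K xbar Df" and "\<epsilon> > 0"
  shows "\<exists>d>0. \<forall>x z. dist x xbar \<le> d \<longrightarrow> x \<noteq> xbar \<longrightarrow> z \<in> K \<longrightarrow>
           norm (f x z - f xbar z - Df z (x - xbar)) \<le> \<epsilon> * norm (x - xbar)"
proof -
  obtain d where d: "d > 0"
    "\<And>x. x \<in> cball xbar d \<Longrightarrow> x \<noteq> xbar \<Longrightarrow>
       (SUP z\<in>K. ereal (norm (f x z - f xbar z - Df z (x - xbar)) / norm (x - xbar))) < ereal \<epsilon>"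
    using assms unfolding B_differentiable_unif_def by blast
  show ?thesis
  proof (intro exI[of _ d] conjI d(1) allI impI)
    fix x z assume x: "dist x xbar \<le> d" "x \<noteq> xbar" "z \<in> K"
    have "ereal (norm (f x z - f xbar z - Df z (x - xbar)) / norm (x - xbar))
        \<le> (SUP z\<in>K. ereal (norm (f x z - f xbar z - Df z (x - xbar)) / norm (x - xbar)))"
      using x(3) by (rule SUP_upper)
    also have "\<dots> < ereal \<epsilon>"
      using x by (intro d(2)) (simp_all add: dist_commute)
    finally have "ereal (norm (f x z - f xbar z - Df z (x - xbar)) / norm (x - xbar)) < ereal \<epsilon>" .
    then show "norm (f x z - f xbar z - Df z (x - xbar)) \<le> \<epsilon> * norm (x - xbar)"
      using x by (simp add: divide_less_eq)
  qed
qed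

text \<open>The first-order model \<open>f xbar z + t *\<^sub>R Df z s\<close> is a sum of two
  elements of the convex cone \<open>C\<close>, so the distance of \<open>f x z\<close> to
  \<open>C\<close> is at most the linearization error, uniformly in \<open>z\<close>.\<close>

lemma merit_le_along_direction:
  assumes C: "convex C" "cone C"
    and xbar: "xbar \<in> SE f C K"
    and Df: "B_differentiable_unif f K xbar Df"
    and s: "\<And>z. z \<in> K \<Longrightarrow> Df z s \<in> C" "s \<noteq> 0"
    and \<epsilon>: "\<epsilon> > 0"
  shows "\<exists>d>0. \<forall>t. 0 < t \<longrightarrow> t < d \<longrightarrow> merit f C K (xbar + t *\<^sub>R s) \<le> ereal (\<epsilon> * t)"
proof -
  \<comment> \<open>The displacement has length \<open>t * norm s\<close>, so this tolerance makes
    the linearization error exactly at most \<open>\<epsilon> * t\<close>.\<close>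
  have pos: "\<epsilon> / norm s > 0" using \<epsilon> s(2) by simp
  obtain r where r: "r > 0"
    "\<And>x z. dist x xbar \<le> r \<Longrightarrow> x \<noteq> xbar \<Longrightarrow> z \<in> K \<Longrightarrow>
       norm (f x z - f xbar z - Df z (x - xbar)) \<le> \<epsilon> / norm s * norm (x - xbar)"
    using B_differentiable_unifD[OF Df pos] by blast
  show ?thesis
  proof (intro exI[of _ "r / norm s"] conjI allI impI)
    show "r / norm s > 0" using r(1) s(2) by simp
    fix t :: real assume t: "0 < t" "t < r / norm s"
    let ?x = "xbar + t *\<^sub>R s"
    have "infdist (f ?x z) C \<le> \<epsilon> * t" if z: "z \<in> K" for z
    proof -
      have hom: "Df z (t *\<^sub>R s) = t *\<^sub>R Df z s"
        using Df z t unfolding B_differentiable_unif_def PH_def by blast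
      have "t *\<^sub>R Df z s \<in> C" using C(2) s(1)[OF z] t by (simp add: mem_cone)
      moreover have "f xbar z \<in> C" using xbar z unfolding SE_def by blast
      ultimately have mem: "f xbar z + t *\<^sub>R Df z s \<in> C"
        using C convex_cone[of C] by simp
      have "dist ?x xbar \<le> r" using t s(2) by (simp add: dist_norm pos_less_divide_eq)
      then have "norm (f ?x z - f xbar z - t *\<^sub>R Df z s) \<le> \<epsilon> * t"
        using r(2)[of ?x z] z s(2) t by (simp add: hom)
      then have "dist (f ?x z) (f xbar z + t *\<^sub>R Df z s) \<le> \<epsilon> * t"
        by (simp add: dist_norm diff_diff_eq)
      then show ?thesis by (rule infdist_le2[OF mem])
    qed
    then show "merit f C K ?x \<le> ereal (\<epsilon> * t)"
      unfolding merit_def by (intro SUP_least) simp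
  qed
qed

text \<open>The error bound converts small merit into closeness to the solution set. It is available
  only on \<open>K\<close>, hence the restriction to those \<open>t\<close> whose ray point lies in
  \<open>K\<close>.\<close>

lemma solution_near_direction:
  assumes C: "convex C" "cone C"
    and xbar: "xbar \<in> SE f C K"
    and Df: "B_differentiable_unif f K xbar Df"
    and eb: "local_error_bound f C K xbar"
    and s: "\<And>z. z \<in> K \<Longrightarrow> Df z s \<in> C" "s \<noteq> 0"
    and \<epsilon>: "\<epsilon> > 0"
  shows "\<exists>d>0. \<forall>t. 0 < t \<longrightarrow> t < d \<longrightarrow> xbar + t *\<^sub>R s \<in> K \<longrightarrow>
           (\<exists>y\<in>SE f C K. dist (xbar + t *\<^sub>R s) y < \<epsilon> * t)"
proof -
  obtain \<kappa> \<delta> where eb: "\<kappa> > 0" "\<delta> > 0"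
    "\<And>x. x \<in> cball xbar \<delta> \<inter> K \<Longrightarrow>
       ereal (infdist x (SE f C K)) \<le> ereal \<kappa> * merit f C K x"
    using eb unfolding local_error_bound_def by blast
  \<comment> \<open>Dividing by \<open>\<kappa>\<close> absorbs the error bound constant; the factor
    2 leaves room for a strict inequality, so a suitable \<open>y\<close> exists even without
    attainment of the infimum.\<close>
  have pos: "\<epsilon> / (2 * \<kappa>) > 0" using \<epsilon> eb(1) by simp
  obtain d where d: "d > 0"
    "\<And>t. 0 < t \<Longrightarrow> t < d \<Longrightarrow> merit f C K (xbar + t *\<^sub>R s) \<le> ereal (\<epsilon> / (2 * \<kappa>) * t)"
    using merit_le_along_direction[OF C xbar Df s pos] by blast
  show ?thesis
  \<comment> \<open>The second bound keeps the ray point in the ball where the error bound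
    holds.\<close>
  proof (intro exI[of _ "min d (\<delta> / norm s)"] conjI allI impI)
    show "min d (\<delta> / norm s) > 0" using d(1) eb(2) s(2) by simp
    fix t :: real assume t: "0 < t" "t < min d (\<delta> / norm s)" and K: "xbar + t *\<^sub>R s \<in> K"
    let ?x = "xbar + t *\<^sub>R s"
    have "?x \<in> cball xbar \<delta>" using t s(2) by (simp add: dist_norm pos_less_divide_eq)
    then have "ereal (infdist ?x (SE f C K)) \<le> ereal \<kappa> * merit f C K ?x"
      using eb(3) K by blast
    also have "\<dots> \<le> ereal \<kappa> * ereal (\<epsilon> / (2 * \<kappa>) * t)"
      using d(2)[of t] t eb(1) by (intro ereal_mult_left_mono) auto
    finally have "infdist ?x (SE f C K) \<le> \<epsilon> * t / 2" using eb(1) by simp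
    also have "\<dots> < \<epsilon> * t" using \<epsilon> t by simp
    finally have less: "infdist ?x (SE f C K) < \<epsilon> * t" .
    \<comment> \<open>\<open>infdist\<close> is a genuine infimum only over a nonempty set; over the
      empty set it is 0 by convention.\<close>
    have nonempty: "SE f C K \<noteq> {}" using xbar by blast
    then have "(INF y\<in>SE f C K. dist ?x y) < \<epsilon> * t"
      using less by (simp add: infdist_notempty)
    with nonempty show "\<exists>y\<in>SE f C K. dist ?x y < \<epsilon> * t"
      by (simp add: cINF_less_iff)
  qed
qed

theorem theorem4p3:
  fixes f :: "real ^ 'n \<Rightarrow> real ^ 'n \<Rightarrow> real ^ 'm"
    and C :: "(real ^ 'm) set"
    and K :: "(real ^ 'n) set"
    and \<theta> :: "real ^ 'n \<Rightarrow> real"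
    and xbar :: "real ^ 'n"
    and Df :: "real ^ 'n \<Rightarrow> real ^ 'n \<Rightarrow> real ^ 'm"
  assumes "closed C" and "convex C" and "cone C" and "pointed C" and "C \<noteq> {0}"
    and "K \<noteq> {}" and "closed K"
    and "continuous_around \<theta> xbar"
    and "local_minimizer_on \<theta> (SE f C K) xbar"
    and "B_differentiable_unif f K xbar Df"
    and "local_error_bound f C K xbar"
  shows "uminus ` frechet_upper_subdiff \<theta> xbar
           \<subseteq> polar_cone ((\<Inter>z\<in>K. Df z -` C) \<inter> radial_cone xbar K)"
proof -
  have xbar: "xbar \<in> SE f C K"
    using assms(9) unfolding local_minimizer_on_def by blast
  obtain r where r: "r > 0" "\<And>y. y \<in> SE f C K \<Longrightarrow> dist xbar y \<le> r \<Longrightarrow> \<theta> xbar \<le> \<theta> y"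
    using assms(9) unfolding local_minimizer_on_def by (auto simp: Int_iff)
  \<comment> \<open>This is polarity of \<open>- v\<close>. The case \<open>s = 0\<close> is split
    off because the preceding estimates divide by \<open>norm s\<close>.\<close>
  have "0 \<le> v \<bullet> s"
    if v: "v \<in> frechet_upper_subdiff \<theta> xbar"
      and s: "\<And>z. z \<in> K \<Longrightarrow> Df z s \<in> C" "s \<in> radial_cone xbar K" "s \<noteq> 0" for v s
  proof -
    have approx: "0 \<le> v \<bullet> s + e * (norm v + norm s + 1)" if e: "0 < e" "e < 1" for e
    proof -
      obtain d1 where d1: "d1 > 0"
        "\<And>y. dist y xbar < d1 \<Longrightarrow> \<theta> y - \<theta> xbar - v \<bullet> (y - xbar) \<le> e * norm (y - xbar)"
        using frechet_upper_subdiffD[OF v e(1)] by blast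
      obtain d2 where d2: "d2 > 0"
        "\<And>t. 0 < t \<Longrightarrow> t < d2 \<Longrightarrow> xbar + t *\<^sub>R s \<in> K \<Longrightarrow>
           \<exists>y\<in>SE f C K. dist (xbar + t *\<^sub>R s) y < e * t"
        using solution_near_direction[OF assms(2,3) xbar assms(10,11) s(1,3) e(1)] by blast
      \<comment> \<open>Since \<open>e < 1\<close>, the solution \<open>y\<close> is within
        \<open>t\<close> of the ray point, so \<open>norm (y - xbar)\<close> is at most
        \<open>t * ?c\<close>. Taking \<open>t\<close> below \<open>min d1 r / ?c\<close> thus puts
        \<open>y\<close> where both the subgradient inequality and local minimality apply.\<close>
      let ?c = "norm s + 1"
      have c: "?c > 0" by (simp add: add_nonneg_pos)
      have "min d2 (min d1 r / ?c) > 0" using d1(1) d2(1) r(1) c by simp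
      then obtain t where t: "0 < t" "t < min d2 (min d1 r / ?c)" "xbar + t *\<^sub>R s \<in> K"
        using s(2) unfolding radial_cone_def by blast
      obtain y where y: "y \<in> SE f C K" "dist (xbar + t *\<^sub>R s) y < e * t"
        using d2(2) t by auto
      define w where "w = y - xbar - t *\<^sub>R s"
      have yw: "y - xbar = t *\<^sub>R s + w" by (simp add: w_def)
      have w: "norm w < e * t"
        using y(2) by (simp add: w_def dist_norm norm_minus_commute diff_diff_eq)
      also have "e * t < t" using e t by simp
      finally have ny: "norm (y - xbar) \<le> t * ?c"
        unfolding yw using t norm_triangle_ineq[of "t *\<^sub>R s" w] by (simp add: algebra_simps)
      have "t * ?c < min d1 r" using t c by (simp add: pos_less_divide_eq)
      then have near: "dist y xbar < d1" "dist xbar y \<le> r"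
        using ny by (auto simp: dist_norm norm_minus_commute)
      have "v \<bullet> w \<le> norm v * norm w" by (rule norm_cauchy_schwarz)
      also have "\<dots> \<le> norm v * (e * t)" using w by (intro mult_left_mono) auto
      finally have vw: "v \<bullet> w \<le> norm v * (e * t)" .
      \<comment> \<open>Minimality bounds \<open>\<theta> y - \<theta> xbar\<close> below by 0, the
        upper subgradient inequality bounds it above.\<close>
      have "0 \<le> v \<bullet> (y - xbar) + e * norm (y - xbar)"
        using d1(2)[OF near(1)] r(2)[OF y(1) near(2)] by linarith
      also have "\<dots> \<le> t * (v \<bullet> s) + norm v * (e * t) + e * (t * ?c)"
      proof (intro add_mono)
        show "v \<bullet> (y - xbar) \<le> t * (v \<bullet> s) + norm v * (e * t)"
          using vw by (simp add: yw inner_add_right)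
        show "e * norm (y - xbar) \<le> e * (t * ?c)"
          using ny e by (intro mult_left_mono) auto
      qed
      also have "\<dots> = t * (v \<bullet> s + e * (norm v + norm s + 1))" by (simp add: algebra_simps)
      finally show ?thesis using t by (simp add: zero_le_mult_iff)
    qed
    \<comment> \<open>The point \<open>t\<close> has been divided out, so the error term depends on
      \<open>e\<close> alone and vanishes as \<open>e\<close> tends to 0 from the right.\<close>
    have lim: "((\<lambda>e. v \<bullet> s + e * (norm v + norm s + 1)) \<longlongrightarrow> v \<bullet> s + 0 * (norm v + norm s + 1))
        (at_right 0)"
      by (intro tendsto_intros)
    have ev: "\<forall>\<^sub>F e in at_right 0. 0 \<le> v \<bullet> s + e * (norm v + norm s + 1)"
      using approx unfolding eventually_at_right_field by (intro exI[of _ 1]) auto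
    show ?thesis
      using tendsto_lowerbound[OF lim ev] by simp
  qed
  then have "0 \<le> v \<bullet> s"
    if "v \<in> frechet_upper_subdiff \<theta> xbar" "s \<in> (\<Inter>z\<in>K. Df z -` C) \<inter> radial_cone xbar K" for v s
    using that by (cases "s = 0") auto
  then show ?thesis
    unfolding polar_cone_def by fastforce
qed

end
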